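(* Let $n\ge 1$, $s\in(0,1)$, and let $q\in C^1(\mathbb{R}^n)$ satisfy $|q(x)|\le 1$ and $|x\cdot\nabla q(x)|\le 1$ for all $x\in\mathbb{R}^n$. Let $u\in H^s(\mathbb{R}^n)$ be a solution of $((-\Delta)^s+q)u=0$ in $\mathbb{R}^n$. Suppose there exist $\alpha>1$ and $C<\infty$ such that $$\int_{\mathbb{R}^n} e^{|x|^{\alpha}}|u(x)|^2\,dx\le C.$$ Then $u\equiv 0$.
   Context: $(-\Delta)^s$ denotes the fractional Laplacian on $\mathbb{R}^n$ (Fourier multiplier $|\xi|^{2s}$), and $H^s(\mathbb{R}^n)$ the standard $L^2$-based Sobolev space of order $s$. The equation is understood in the weak sense. *)

theory Defs
  imports "HOL-Analysis.Analysis"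
begin

definition L2 :: "(real^'n \<Rightarrow> complex) \<Rightarrow> bool" where
  "L2 f \<longleftrightarrow> f \<in> borel_measurable lebesgue \<and> integrable lebesgue (\<lambda>x. (cmod (f x))\<^sup>2)"

text \<open>Fourier transform of an integrable function, convention
  hat f (xi) = integral of exp(-i x.xi) f(x) dx, so that (-Delta)^s has symbol |xi|^(2s).\<close>
definition fourier_L1 :: "(real^'n \<Rightarrow> complex) \<Rightarrow> real^'n \<Rightarrow> complex" where
  "fourier_L1 f \<xi> = (\<integral>x. cis (- (x \<bullet> \<xi>)) * f x \<partial>lebesgue)"

text \<open>U is (a representative of) the L^2 (Plancherel) Fourier transform of u:
  U is in L^2 and satisfies the multiplication formula against all test functions
  psi in L^1 \<inter> L^2 whose Fourier transform is in L^2 (a dense class).\<close>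
definition is_L2_fourier :: "(real^'n \<Rightarrow> complex) \<Rightarrow> (real^'n \<Rightarrow> complex) \<Rightarrow> bool" where
  "is_L2_fourier u U \<longleftrightarrow> L2 U \<and>
     (\<forall>\<psi>. integrable lebesgue \<psi> \<and> L2 \<psi> \<and> L2 (fourier_L1 \<psi>) \<longrightarrow>
        (\<integral>\<xi>. U \<xi> * \<psi> \<xi> \<partial>lebesgue) = (\<integral>x. u x * fourier_L1 \<psi> x \<partial>lebesgue))"

definition Hs :: "real \<Rightarrow> (real^'n \<Rightarrow> complex) \<Rightarrow> bool" where
  "Hs s u \<longleftrightarrow> L2 u \<and> (\<exists>U. is_L2_fourier u U \<and>
     integrable lebesgue (\<lambda>\<xi>. (1 + (norm \<xi>)\<^sup>2) powr s * (cmod (U \<xi>))\<^sup>2))"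

definition weak_frac_schroedinger :: "real \<Rightarrow> (real^'n \<Rightarrow> real) \<Rightarrow> (real^'n \<Rightarrow> complex) \<Rightarrow> bool" where
  "weak_frac_schroedinger s q u \<longleftrightarrow> Hs s u \<and>
     (\<forall>\<phi> U \<Phi>. Hs s \<phi> \<and> is_L2_fourier u U \<and> is_L2_fourier \<phi> \<Phi> \<longrightarrow>
        complex_of_real (1 / (2 * pi) ^ CARD('n)) *
          (\<integral>\<xi>. complex_of_real ((norm \<xi>) powr (2 * s)) * U \<xi> * cnj (\<Phi> \<xi>) \<partial>lebesgue)
        + (\<integral>x. complex_of_real (q x) * u x * cnj (\<phi> x) \<partial>lebesgue) = 0)"

end

theory Submission
  imports Defs "HOL-Probability.Characteristic_Functions" "HOL-Probability.Sinc_Integral"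
    "HOL-Complex_Analysis.Conformal_Mappings"
begin

text \<open>Let \<open>F\<close> and \<open>G\<close> be the Fourier transforms of \<open>u\<close> and
  \<open>q u\<close>. The equation reads \<open>norm \<xi> powr (2 * s) * F \<xi> + G \<xi> = 0\<close>, and by
  the decay of \<open>u\<close> both \<open>F\<close> and \<open>G\<close> extend to entire functions along every
  line through the origin. Continuing the identity from one half-line to the opposite one through the
  complex plane multiplies the first term by \<open>exp (2 * pi * \<i> * s)\<close>, whereas on the
  real line there is no such factor. As \<open>s\<close> is not an integer, \<open>F\<close> vanishes.\<close>

text \<open>The obstacle is that \<open>is_L2_fourier\<close> fixes \<open>U\<close> only up to null
  sets and the weak equation speaks of \<open>U\<close> alone, while the continuation runs along a
  ray, itself a null set when n > 1. So \<open>U\<close> has to be replaced by the continuous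
  function \<open>fourier_L1 u\<close>, after which the a.e. identity holds everywhere. Translated
  Gaussians suffice as test functions: they lie in \<open>Hs s\<close>, their transforms are
  explicit Gaussians again, and integrating the unknown against such a transform gives a Fourier
  transform of the unknown times \<open>gauss\<close>. Hence one uniqueness theorem for integrable
  functions settles both the replacement of \<open>U\<close> and the equation. Restricting to lines
  keeps the complex analysis in one variable. The exponent \<alpha> > 1 enters by making
  \<open>exp (R * norm x) * cmod (u x)\<close> integrable for every R, and q u inherits this from
  \<open>\<bar>q x\<bar> \<le> 1\<close>.\<close>

section \<open>Fubini, product integrals and affine substitution for Lebesgue measure\<close>

text \<open>Needed for Fubini: \<open>lebesgue\<close> is a completion, and the sets exhausting the
  original space keep their measure.\<close>

lemma sigma_finite_completion:
  assumes "sigma_finite_measure M"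
  shows "sigma_finite_measure (completion M)"
proof
  obtain A where "countable A" "A \<subseteq> sets M" "\<Union>A = space M" "\<forall>a\<in>A. emeasure M a \<noteq> \<infinity>"
    using assms unfolding sigma_finite_measure_def by blast
  then show "\<exists>A. countable A \<and> A \<subseteq> sets (completion M) \<and> \<Union>A = space (completion M) \<and>
      (\<forall>a\<in>A. emeasure (completion M) a \<noteq> \<infinity>)"
    by (intro exI[of _ A]) (auto simp: subset_eq sets_completionI_sets)
qed

lemma pair_sigma_finite_lebesgue: "pair_sigma_finite lebesgue lebesgue"
  by (intro pair_sigma_finite.intro sigma_finite_completion sigma_finite_lborel)

text \<open>The product of two completions need not be complete, but it contains all Borel sets,
  since both projections are measurable into \<open>borel\<close>.\<close>

lemma borel_measurable_lebesgue_pair: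
  fixes K :: "'a::euclidean_space \<times> 'b::euclidean_space \<Rightarrow> 'c::topological_space"
  assumes "K \<in> borel_measurable borel"
  shows "K \<in> borel_measurable (lebesgue \<Otimes>\<^sub>M lebesgue)"
proof -
  have 1: "(\<lambda>x::'a. x) \<in> lebesgue \<rightarrow>\<^sub>M borel" "(\<lambda>x::'b. x) \<in> lebesgue \<rightarrow>\<^sub>M borel"
    by (auto intro: measurable_completion)
  have "(\<lambda>p. (fst p, snd p)) \<in> lebesgue \<Otimes>\<^sub>M lebesgue \<rightarrow>\<^sub>M (borel :: ('a \<times> 'b) measure)"
    unfolding borel_prod[symmetric]
    by (intro measurable_Pair measurable_compose[OF measurable_fst 1(1)] measurable_compose[OF measurable_snd 1(2)])
  from measurable_compose[OF this assms] show ?thesis by simp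
qed

text \<open>The integrand is dominated by \<open>B * cmod (f x * g y)\<close>. This one exchange
  serves the Fourier kernel and the Gaussian smoothing kernel alike.\<close>

lemma Fubini_bounded_kernel:
  fixes f :: "'a::euclidean_space \<Rightarrow> complex" and g :: "'b::euclidean_space \<Rightarrow> complex"
    and K :: "'a \<Rightarrow> 'b \<Rightarrow> complex"
  assumes f: "integrable lebesgue f" and g: "integrable lebesgue g"
    and K: "continuous_on UNIV (\<lambda>p. K (fst p) (snd p))" and B: "\<And>x y. cmod (K x y) \<le> B"
  shows "(\<integral>x. f x * (\<integral>y. K x y * g y \<partial>lebesgue) \<partial>lebesgue) =
         (\<integral>y. g y * (\<integral>x. K x y * f x \<partial>lebesgue) \<partial>lebesgue)"
proof -
  interpret pair_sigma_finite "lebesgue :: 'a measure" "lebesgue :: 'b measure"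
    by (rule pair_sigma_finite_lebesgue)
  have [measurable]: "f \<in> borel_measurable lebesgue" "g \<in> borel_measurable lebesgue"
    using f g by auto
  have [measurable]: "(\<lambda>p. K (fst p) (snd p)) \<in> borel_measurable (lebesgue \<Otimes>\<^sub>M lebesgue)"
    by (rule borel_measurable_lebesgue_pair[OF borel_measurable_continuous_onI[OF K]])
  have B0: "B \<ge> 0" using B[of 0 0] norm_ge_zero order_trans by blast
  have "integrable (lebesgue \<Otimes>\<^sub>M lebesgue) (\<lambda>p. f (fst p) * g (snd p))"
  proof (rule Fubini_integrable)
    show "integrable lebesgue (\<lambda>x. \<integral>y. norm (f (fst (x, y)) * g (snd (x, y))) \<partial>lebesgue)"
      using f g by (auto simp: norm_mult)
    show "AE x in lebesgue. integrable lebesgue (\<lambda>y. f (fst (x, y)) * g (snd (x, y)))"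
      using f g by auto
  qed auto
  then have "integrable (lebesgue \<Otimes>\<^sub>M lebesgue) (\<lambda>p. B * cmod (f (fst p) * g (snd p)))"
    by auto
  then have "integrable (lebesgue \<Otimes>\<^sub>M lebesgue) (\<lambda>p. f (fst p) * (K (fst p) (snd p) * g (snd p)))"
  proof (rule Bochner_Integration.integrable_bound)
    show "AE p in lebesgue \<Otimes>\<^sub>M lebesgue. norm (f (fst p) * (K (fst p) (snd p) * g (snd p))) \<le> norm (B * cmod (f (fst p) * g (snd p)))"
    proof (rule AE_I2)
      fix p :: "'a \<times> 'b"
      have "cmod (f (fst p) * g (snd p)) * cmod (K (fst p) (snd p)) \<le> cmod (f (fst p) * g (snd p)) * B"
        by (intro mult_left_mono B norm_ge_zero)
      then show "norm (f (fst p) * (K (fst p) (snd p) * g (snd p))) \<le> norm (B * cmod (f (fst p) * g (snd p)))"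
        using B0 by (simp add: norm_mult mult_ac abs_mult)
    qed
  qed auto
  then have I: "integrable (lebesgue \<Otimes>\<^sub>M lebesgue) (\<lambda>(x,y). f x * (K x y * g y))"
    by (simp add: case_prod_beta')
  show ?thesis
    using Fubini_integral[OF I] by (simp add: mult_ac flip: integral_mult_right_zero)
qed

text \<open>Through \<open>lborel_eq\<close>, Lebesgue measure is the image of a product of
  one-dimensional ones, which reduces Gaussian and exponential integrals to the line.\<close>

lemma integrable_prod_Basis:
  fixes f :: "'a::euclidean_space \<Rightarrow> real \<Rightarrow> 'b::{real_normed_field,banach,second_countable_topology}"
  assumes f: "\<And>b. b \<in> Basis \<Longrightarrow> integrable lborel (f b)"
  shows "integrable lborel (\<lambda>x. \<Prod>b\<in>Basis. f b (x \<bullet> b))"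
    and "(\<integral>x. (\<Prod>b\<in>Basis. f b (x \<bullet> b)) \<partial>lborel) = (\<Prod>b\<in>Basis. \<integral>t. f b t \<partial>lborel)"
proof -
  interpret product_sigma_finite "\<lambda>_::'a. lborel :: real measure" ..
  have [measurable]: "b \<in> Basis \<Longrightarrow> f b \<in> borel_measurable borel" for b using f[of b] by auto
  have eq: "(\<Prod>b\<in>Basis. f b ((\<Sum>c\<in>Basis. y c *\<^sub>R c) \<bullet> b)) = (\<Prod>b\<in>Basis. f b (y b))" for y
    by (intro prod.cong) (auto simp: inner_sum_left inner_Basis if_distrib cong: if_cong)
  show "integrable lborel (\<lambda>x. \<Prod>b\<in>Basis. f b (x \<bullet> b))"
    by (subst lborel_eq, subst integrable_distr_eq) (auto simp: eq intro!: product_integrable_prod f)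
  show "(\<integral>x. (\<Prod>b\<in>Basis. f b (x \<bullet> b)) \<partial>lborel) = (\<Prod>b\<in>Basis. \<integral>t. f b t \<partial>lborel)"
    by (subst lborel_eq, subst integral_distr) (auto simp: eq product_integral_prod f)
qed

lemma lborel_integral_affine:
  fixes f :: "'a::euclidean_space \<Rightarrow> 'b::{banach, second_countable_topology}"
  assumes [measurable]: "f \<in> borel_measurable borel" and c: "c \<noteq> 0"
  shows "(\<integral>x. f x \<partial>lborel) = \<bar>c\<bar> ^ DIM('a) *\<^sub>R (\<integral>x. f (t + c *\<^sub>R x) \<partial>lborel)"
  by (subst lborel_affine[OF c, of t])
     (simp add: ennreal_power integral_density integral_distr)

subsection \<open>Gaussians\<close>

text \<open>The factor 1/2 makes \<open>gauss\<close> an eigenfunction of the transform, with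
  eigenvalue \<open>sqrt (2 * pi) ^ DIM('a)\<close>.\<close>

definition gauss :: "'a::euclidean_space \<Rightarrow> real"
  where "gauss x = exp (- (norm x)\<^sup>2 / 2)"

lemma gauss_pos: "gauss x > 0"
  and gauss_le_1: "gauss x \<le> 1"
  and gauss_0: "gauss 0 = 1"
  and gauss_minus: "gauss (- x) = gauss x"
  by (auto simp: gauss_def)

lemma continuous_on_gauss [continuous_intros]:
  "continuous_on A f \<Longrightarrow> continuous_on A (\<lambda>x. gauss (f x))"
  unfolding gauss_def by (intro continuous_intros) auto

lemma borel_measurable_gauss [measurable]: "gauss \<in> borel_measurable borel"
  by (intro borel_measurable_continuous_onI continuous_intros)

lemma gauss_prod: "gauss x = (\<Prod>b\<in>Basis. gauss (x \<bullet> b))"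
proof -
  have "(norm x)\<^sup>2 = (\<Sum>b\<in>Basis. (x \<bullet> b)\<^sup>2)"
    unfolding power2_norm_eq_inner by (subst euclidean_inner) (simp add: power2_eq_square)
  then have "- (norm x)\<^sup>2 / 2 = (\<Sum>b\<in>Basis. - (norm (x \<bullet> b))\<^sup>2 / 2)"
    by (simp add: sum_negf sum_divide_distrib)
  then show ?thesis
    unfolding gauss_def by (simp add: exp_sum)
qed

text \<open>Up to the factor \<open>sqrt (2 * pi)\<close> this is the characteristic function of the
  standard normal distribution at -t.\<close>

lemma fourier_gauss_real:
  shows "integrable lborel (\<lambda>x::real. complex_of_real (gauss x) * cis (- (x * t)))"
    and "(\<integral>x. gauss (x::real) * cis (- (x * t)) \<partial>lborel) = complex_of_real (sqrt (2 * pi) * gauss t)"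
proof -
  have g: "gauss x = sqrt (2 * pi) * std_normal_density x" for x :: real
    by (simp add: gauss_def std_normal_density_def)
  have "integrable lborel (\<lambda>x::real. gauss x)"
    unfolding g using integrable_std_normal_moment[of 0] by simp
  then have "integrable lborel (\<lambda>x::real. complex_of_real (gauss x))" by simp
  then show "integrable lborel (\<lambda>x::real. complex_of_real (gauss x) * cis (- (x * t)))"
    by (rule Bochner_Integration.integrable_bound)
       (auto simp: norm_mult cis_conv_exp)
  have "complex_of_real (gauss t) = char std_normal_distribution (- t)"
    by (simp add: char_std_normal_distribution gauss_def)
  also have "\<dots> = (\<integral>x. std_normal_density x *\<^sub>R cis (- (x * t)) \<partial>lborel)"
    unfolding char_def by (subst integral_density) (auto simp: cis_conv_exp mult_ac)
  also have "complex_of_real (sqrt (2 * pi)) * \<dots> = (\<integral>x. gauss (x::real) * cis (- (x * t)) \<partial>lborel)"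
    by (subst integral_mult_right_zero[symmetric]) (simp add: g scaleR_conv_of_real mult_ac)
  finally show "(\<integral>x. gauss (x::real) * cis (- (x * t)) \<partial>lborel) = complex_of_real (sqrt (2 * pi) * gauss t)"
    by simp
qed

lemma cis_inner_prod: "cis (- (x \<bullet> y)) = (\<Prod>b\<in>Basis. cis (- ((x \<bullet> b) * (y \<bullet> b))))"
proof -
  have "\<i> * complex_of_real (- (x \<bullet> y)) = (\<Sum>b\<in>Basis. \<i> * complex_of_real (- ((x \<bullet> b) * (y \<bullet> b))))"
    by (subst euclidean_inner) (simp add: sum_negf sum_distrib_left)
  then show ?thesis
    unfolding cis_conv_exp by (simp only: exp_sum finite_Basis)
qed

lemma fourier_gauss:
  fixes y :: "'a::euclidean_space"
  shows "integrable lborel (\<lambda>x. complex_of_real (gauss x) * cis (- (x \<bullet> y)))"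
    and "(\<integral>x. gauss x * cis (- (x \<bullet> y)) \<partial>lborel) = complex_of_real (sqrt (2 * pi) ^ DIM('a) * gauss y)"
proof -
  have eq: "complex_of_real (gauss x) * cis (- (x \<bullet> y)) =
    (\<Prod>b\<in>Basis. complex_of_real (gauss (x \<bullet> b)) * cis (- ((x \<bullet> b) * (y \<bullet> b))))" for x
    by (subst gauss_prod, subst cis_inner_prod) (simp add: prod.distrib)
  show "integrable lborel (\<lambda>x. complex_of_real (gauss x) * cis (- (x \<bullet> y)))"
    unfolding eq
    by (rule integrable_prod_Basis(1)[of "\<lambda>b t. complex_of_real (gauss t) * cis (- (t * (y \<bullet> b)))"])
       (rule fourier_gauss_real)
  show "(\<integral>x. gauss x * cis (- (x \<bullet> y)) \<partial>lborel) = complex_of_real (sqrt (2 * pi) ^ DIM('a) * gauss y)"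
    unfolding eq
    by (subst integrable_prod_Basis(2)[of "\<lambda>b t. complex_of_real (gauss t) * cis (- (t * (y \<bullet> b)))"])
       (simp_all add: fourier_gauss_real gauss_prod[of y] prod.distrib)
qed

lemma integrable_gauss: "integrable lborel (gauss :: 'a::euclidean_space \<Rightarrow> real)"
proof -
  have "integrable lborel (\<lambda>x::'a. complex_of_real (gauss x))"
    using fourier_gauss(1)[of "0::'a"] by simp
  then show ?thesis unfolding complex_of_real_integrable_eq .
qed

lemma integral_gauss: "(\<integral>x. gauss (x::'a::euclidean_space) \<partial>lborel) = sqrt (2 * pi) ^ DIM('a)"
proof -
  have "complex_of_real (\<integral>x. gauss (x::'a) \<partial>lborel) = complex_of_real (sqrt (2 * pi) ^ DIM('a))"
    using fourier_gauss(2)[of "0::'a"] by (simp add: gauss_0)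
  then show ?thesis unfolding of_real_eq_iff .
qed

section \<open>The multiplication formula and explicit transforms of Gaussians\<close>

lemma continuous_on_fourier_kernel:
  "continuous_on UNIV (\<lambda>p. cis (- (snd p \<bullet> fst p)) :: complex)"
  by (intro continuous_intros)

lemma fourier_L1_multiplication:
  assumes "integrable lebesgue f" "integrable lebesgue g"
  shows "(\<integral>x. f x * fourier_L1 g x \<partial>lebesgue) = (\<integral>x. g x * fourier_L1 f x \<partial>lebesgue)"
proof -
  have "(\<integral>x. f x * fourier_L1 g x \<partial>lebesgue) = (\<integral>y. g y * (\<integral>x. cis (- (y \<bullet> x)) * f x \<partial>lebesgue) \<partial>lebesgue)"
    unfolding fourier_L1_def
    by (rule Fubini_bounded_kernel[OF assms, of "\<lambda>x y. cis (- (y \<bullet> x))" 1])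
       (auto intro: continuous_on_fourier_kernel)
  then show ?thesis
    unfolding fourier_L1_def by (simp add: inner_commute)
qed

lemma fourier_L1_eq_lborel:
  assumes "f \<in> borel_measurable borel"
  shows "fourier_L1 f \<xi> = (\<integral>x. cis (- (x \<bullet> \<xi>)) * f x \<partial>lborel)"
  unfolding fourier_L1_def
proof (rule integral_completion)
  have "(\<lambda>x. cis (- (x \<bullet> \<xi>))) \<in> borel_measurable borel"
    by (intro borel_measurable_continuous_onI continuous_intros)
  then show "(\<lambda>x. cis (- (x \<bullet> \<xi>)) * f x) \<in> borel_measurable lborel"
    using assms by simp
qed

text \<open>Modulation by y moves the centre of the transform to y and dilation by c gives it width
  c, so small c yields an approximate identity at y.\<close>

lemma fourier_L1_gauss_modulated:
  fixes x y :: "real^'n"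
  assumes c: "c > 0"
  shows "fourier_L1 (\<lambda>\<xi>. cis (\<xi> \<bullet> y) * complex_of_real (gauss (c *\<^sub>R \<xi>))) x =
    complex_of_real (sqrt (2 * pi) ^ CARD('n) / c ^ CARD('n) * gauss ((x - y) /\<^sub>R c))"
proof -
  \<comment> \<open>The integrand after the substitution \<zeta> = c \<xi>.\<close>
  define f where "f \<zeta> = complex_of_real (gauss \<zeta>) * cis (- (\<zeta> \<bullet> ((x - y) /\<^sub>R c)))" for \<zeta> :: "real^'n"
  have [measurable]: "f \<in> borel_measurable borel"
    unfolding f_def by (intro borel_measurable_continuous_onI continuous_intros)
  have eq: "cis (- (\<xi> \<bullet> x)) * (cis (\<xi> \<bullet> y) * complex_of_real (gauss (c *\<^sub>R \<xi>))) = f (0 + c *\<^sub>R \<xi>)" for \<xi>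
  proof -
    have "(c *\<^sub>R \<xi>) \<bullet> ((x - y) /\<^sub>R c) = \<xi> \<bullet> x - \<xi> \<bullet> y"
      using c by (simp add: inner_diff_right field_simps)
    then show ?thesis unfolding f_def by (simp add: cis_mult)
  qed
  have "fourier_L1 (\<lambda>\<xi>. cis (\<xi> \<bullet> y) * complex_of_real (gauss (c *\<^sub>R \<xi>))) x = (\<integral>\<xi>. f (0 + c *\<^sub>R \<xi>) \<partial>lborel)"
    by (subst fourier_L1_eq_lborel)
       (auto simp: eq intro!: borel_measurable_continuous_onI continuous_intros)
  also have "c ^ CARD('n) *\<^sub>R \<dots> = (\<integral>\<zeta>. f \<zeta> \<partial>lborel)"
    using lborel_integral_affine[of f c 0] c by simp
  also have "\<dots> = complex_of_real (sqrt (2 * pi) ^ CARD('n) * gauss ((x - y) /\<^sub>R c))"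
    unfolding f_def by (subst fourier_gauss(2)) simp
  finally show ?thesis
    using c by (simp add: field_simps scaleR_conv_of_real)
qed

lemma fourier_L1_gauss_translated:
  fixes y \<xi> :: "real^'n"
  shows "fourier_L1 (\<lambda>x. complex_of_real (gauss (x - y))) \<xi> =
    complex_of_real (sqrt (2 * pi) ^ CARD('n) * gauss \<xi>) * cis (- (y \<bullet> \<xi>))"
proof -
  define f where "f x = cis (- (x \<bullet> \<xi>)) * complex_of_real (gauss (x - y))" for x
  have [measurable]: "f \<in> borel_measurable borel"
    unfolding f_def by (intro borel_measurable_continuous_onI continuous_intros)
  have eq: "f (y + 1 *\<^sub>R x) = cis (- (y \<bullet> \<xi>)) * (complex_of_real (gauss x) * cis (- (x \<bullet> \<xi>)))" for x
    by (simp add: f_def cis_mult inner_add_left algebra_simps)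
  have "fourier_L1 (\<lambda>x. complex_of_real (gauss (x - y))) \<xi> = (\<integral>x. f x \<partial>lborel)"
    unfolding f_def by (subst fourier_L1_eq_lborel)
       (auto intro!: borel_measurable_continuous_onI continuous_intros)
  also have "\<dots> = (\<integral>x. f (y + 1 *\<^sub>R x) \<partial>lborel)"
    using lborel_integral_affine[of f 1 y] by simp
  also have "\<dots> = cis (- (y \<bullet> \<xi>)) * complex_of_real (sqrt (2 * pi) ^ CARD('n) * gauss \<xi>)"
    unfolding eq by (subst integral_mult_right_zero, subst fourier_gauss(2)) simp
  finally show ?thesis by (simp add: mult_ac)
qed

lemma integrable_gauss_affine:
  assumes "c \<noteq> 0"
  shows "integrable lborel (\<lambda>x::'a::euclidean_space. gauss (c *\<^sub>R (x - y)))"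
proof -
  have "integrable lborel (gauss :: 'a \<Rightarrow> real)" by (rule integrable_gauss)
  then have "integrable (density (distr lborel borel (\<lambda>x. - (c *\<^sub>R y) + c *\<^sub>R x)) (\<lambda>_. \<bar>c\<bar> ^ DIM('a))) (gauss :: 'a \<Rightarrow> real)"
    by (subst (asm) lborel_affine[OF assms, of "- (c *\<^sub>R y)"]) (simp add: ennreal_power)
  then have "integrable lborel (\<lambda>x. \<bar>c\<bar> ^ DIM('a) * gauss (- (c *\<^sub>R y) + c *\<^sub>R x :: 'a))"
    by (simp add: integrable_density integrable_distr_eq)
  then show ?thesis
    using assms by (simp add: algebra_simps)
qed

text \<open>Common source of integrability for the test functions, truncated approximants and
  products with \<open>gauss\<close> used below.\<close>

lemma integrable_lebesgue_gauss_modulated: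
  fixes f :: "'a::euclidean_space \<Rightarrow> complex"
  assumes "continuous_on UNIV f" "\<And>x. cmod (f x) \<le> B" "c \<noteq> 0"
  shows "integrable lebesgue (\<lambda>x. f x * complex_of_real (gauss (c *\<^sub>R (x - y))))"
proof -
  have B: "B \<ge> 0" using assms(2)[of 0] norm_ge_zero order_trans by blast
  have m: "(\<lambda>x. f x * complex_of_real (gauss (c *\<^sub>R (x - y)))) \<in> borel_measurable borel"
    by (intro borel_measurable_continuous_onI continuous_intros assms)
  have "integrable lborel (\<lambda>x. B * gauss (c *\<^sub>R (x - y)))"
    by (rule integrable_mult_right) (rule integrable_gauss_affine[OF assms(3)])
  then have "integrable lborel (\<lambda>x. f x * complex_of_real (gauss (c *\<^sub>R (x - y))))"
    by (rule Bochner_Integration.integrable_bound)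
       (use m B assms(2) in \<open>auto simp: norm_mult abs_mult less_imp_le[OF gauss_pos] intro!: mult_right_mono\<close>)
  then show ?thesis
    using m by (simp add: integrable_completion)
qed

subsection \<open>Injectivity of the Fourier transform on integrable functions\<close>

text \<open>The pairings of \<open>g\<close> with all translated and dilated Gaussians vanish by the multiplication
  formula; they form an approximate identity, so \<open>g\<close> annihilates bounded continuous
  functions, and finally a.e. limits of such, in particular \<open>sgn (cnj g)\<close>.\<close>
lemma fourier_L1_inj:
  fixes g :: "real^'n \<Rightarrow> complex"
  assumes g: "integrable lebesgue g" and g0: "AE \<xi> in lebesgue. fourier_L1 g \<xi> = 0"
  shows "AE x in lebesgue. g x = 0"
proof -
  have [measurable]: "g \<in> borel_measurable lebesgue" using g by auto
  have gauss0: "(\<integral>x. g x * complex_of_real (gauss ((x - y) /\<^sub>R c)) \<partial>lebesgue) = 0" if c: "c > 0" for y c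
  proof -
    define \<psi> where "\<psi> \<xi> = cis (\<xi> \<bullet> y) * complex_of_real (gauss (c *\<^sub>R \<xi>))" for \<xi> :: "real^'n"
    have "continuous_on UNIV (\<lambda>\<xi>. cis (\<xi> \<bullet> y))"
      by (intro continuous_intros)
    from integrable_lebesgue_gauss_modulated[OF this, of 1 c 0] c
    have \<psi>: "integrable lebesgue \<psi>"
      by (simp add: \<psi>_def[abs_def])
    define C where "C = complex_of_real (sqrt (2 * pi) ^ CARD('n) / c ^ CARD('n))"
    have "C \<noteq> 0" using c by (simp add: C_def)
    have F: "fourier_L1 \<psi> x = C * complex_of_real (gauss ((x - y) /\<^sub>R c))" for x
      unfolding \<psi>_def C_def by (subst fourier_L1_gauss_modulated[OF c]) simp
    have "C * (\<integral>x. g x * complex_of_real (gauss ((x - y) /\<^sub>R c)) \<partial>lebesgue) = (\<integral>x. g x * fourier_L1 \<psi> x \<partial>lebesgue)"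
      unfolding F by (subst integral_mult_right_zero[symmetric]) (simp add: mult_ac)
    also have "\<dots> = (\<integral>\<xi>. \<psi> \<xi> * fourier_L1 g \<xi> \<partial>lebesgue)"
      by (rule fourier_L1_multiplication[OF g \<psi>])
    also have "\<dots> = 0"
      by (rule integral_eq_zero_AE) (use g0 in auto)
    finally show ?thesis using \<open>C \<noteq> 0\<close> by simp
  qed
  \<comment> \<open>Integrability of \<open>h\<close> is for the exchange of integrals, boundedness
    for the dominated limit.\<close>
  have cont0: "(\<integral>x. g x * h x \<partial>lebesgue) = 0"
    if ch: "continuous_on UNIV h" and ih: "integrable lebesgue h" and B: "\<And>x. cmod (h x) \<le> B" for h B
  proof -
    have [measurable]: "h \<in> borel_measurable borel"
      using ch by (rule borel_measurable_continuous_onI)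
    have B0: "B \<ge> 0" using B[of 0] norm_ge_zero order_trans by blast
    define \<delta> where "\<delta> k = inverse (real (Suc k))" for k
    have \<delta>: "\<delta> k > 0" for k by (simp add: \<delta>_def)
    \<comment> \<open>The convolution of \<open>h\<close> with a Gaussian of width
      \<open>\<delta> k\<close>, written in the rescaled variable z; it tends to
      \<open>G * h x\<close>.\<close>
    define I where "I k x = (\<integral>z. complex_of_real (gauss z) * h (x + \<delta> k *\<^sub>R z) \<partial>lborel)" for k x
    define G where "G = sqrt (2 * pi) ^ CARD('n)"
    have G: "(\<integral>z. gauss (z::real^'n) \<partial>lborel) = G" by (simp add: G_def integral_gauss)
    have I0: "(\<integral>x. g x * I k x \<partial>lebesgue) = 0" for k
    proof -
      define d where "d = \<delta> k"
      have d: "d > 0" by (simp add: d_def \<delta>)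
      have *: "(\<integral>y. complex_of_real (gauss ((x - y) /\<^sub>R d)) * h y \<partial>lebesgue) = d ^ CARD('n) *\<^sub>R I k x" for x
      proof -
        have "(\<integral>y. complex_of_real (gauss ((x - y) /\<^sub>R d)) * h y \<partial>lebesgue) =
              (\<integral>y. complex_of_real (gauss ((x - y) /\<^sub>R d)) * h y \<partial>lborel)"
          by (rule integral_completion) (auto intro!: borel_measurable_continuous_onI continuous_intros ch)
        also have "\<dots> = d ^ CARD('n) *\<^sub>R (\<integral>z. complex_of_real (gauss ((x - (x + d *\<^sub>R z)) /\<^sub>R d)) * h (x + d *\<^sub>R z) \<partial>lborel)"
          by (subst lborel_integral_affine[of _ d x])
             (use d in \<open>auto intro!: borel_measurable_continuous_onI continuous_intros ch\<close>)
        also have "\<dots> = d ^ CARD('n) *\<^sub>R I k x"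
          using d by (simp add: I_def d_def gauss_minus)
        finally show ?thesis .
      qed
      have cont: "continuous_on UNIV (\<lambda>p. complex_of_real (gauss ((fst p - snd p :: real^'n) /\<^sub>R d)))"
        by (intro continuous_intros)
      have bd: "cmod (complex_of_real (gauss ((x - y :: real^'n) /\<^sub>R d))) \<le> 1" for x y
        by (simp add: gauss_le_1 less_imp_le[OF gauss_pos])
      \<comment> \<open>The exchange moves the smoothing from \<open>h\<close> to \<open>g\<close>,
        where \<open>gauss0\<close> applies.\<close>
      have "(\<integral>x. g x * (d ^ CARD('n) *\<^sub>R I k x) \<partial>lebesgue) =
            (\<integral>y. h y * (\<integral>x. complex_of_real (gauss ((x - y) /\<^sub>R d)) * g x \<partial>lebesgue) \<partial>lebesgue)"
        unfolding *[symmetric]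
        by (rule Fubini_bounded_kernel[OF g ih cont bd])
      also have "\<dots> = 0"
        using gauss0[OF d] by (simp add: mult.commute)
      finally show ?thesis using d by (simp only: mult_scaleR_right integral_scaleR_right scaleR_eq_0_iff) simp
    qed
    have Ilim: "(\<lambda>k. I k x) \<longlonglongrightarrow> complex_of_real G * h x" for x
    proof -
      have "(\<lambda>k. I k x) \<longlonglongrightarrow> (\<integral>z. complex_of_real (gauss (z::real^'n)) * h x \<partial>lborel)"
        unfolding I_def
      proof (rule integral_dominated_convergence[where w="\<lambda>z. B * gauss z"])
        show "integrable lborel (\<lambda>z::real^'n. B * gauss z)"
          using integrable_gauss by auto
        show "AE z in lborel. (\<lambda>k. complex_of_real (gauss z) * h (x + \<delta> k *\<^sub>R z)) \<longlonglongrightarrow> complex_of_real (gauss z) * h x"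
        proof (rule AE_I2)
          fix z
          have "(\<lambda>k. x + \<delta> k *\<^sub>R z) \<longlonglongrightarrow> x + 0 *\<^sub>R z"
            unfolding \<delta>_def by (intro tendsto_intros LIMSEQ_inverse_real_of_nat)
          moreover have "isCont h (x + 0 *\<^sub>R z)"
            using ch by (simp add: continuous_on_eq_continuous_at)
          ultimately have "(\<lambda>k. h (x + \<delta> k *\<^sub>R z)) \<longlonglongrightarrow> h (x + 0 *\<^sub>R z)"
            by (rule isCont_tendsto_compose[rotated])
          then have "(\<lambda>k. h (x + \<delta> k *\<^sub>R z)) \<longlonglongrightarrow> h x"
            by simp
          then show "(\<lambda>k. complex_of_real (gauss z) * h (x + \<delta> k *\<^sub>R z)) \<longlonglongrightarrow> complex_of_real (gauss z) * h x"
            by (intro tendsto_intros)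
        qed
        show "AE z in lborel. norm (complex_of_real (gauss z) * h (x + \<delta> k *\<^sub>R z)) \<le> B * gauss z" for k
          using B by (auto simp: norm_mult less_imp_le[OF gauss_pos] mult.commute[of B] intro!: mult_left_mono AE_I2)
      qed auto
      then show ?thesis by (simp add: G)
    qed
    have Ibd: "cmod (I k x) \<le> B * G" for k x
    proof -
      have "cmod (I k x) \<le> (\<integral>z. B * gauss (z::real^'n) \<partial>lborel)"
        unfolding I_def
      proof (rule order_trans[OF integral_norm_bound integral_mono[OF integrable_norm]])
        have "continuous_on UNIV (\<lambda>z. h (x + \<delta> k *\<^sub>R z))"
          by (intro continuous_on_compose2[OF ch] continuous_intros) auto
        then have "integrable lebesgue (\<lambda>z. h (x + \<delta> k *\<^sub>R z) * complex_of_real (gauss (1 *\<^sub>R (z - 0))))"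
          by (rule integrable_lebesgue_gauss_modulated) (use B in auto)
        then show "integrable lborel (\<lambda>z. complex_of_real (gauss z) * h (x + \<delta> k *\<^sub>R z))"
          by (subst (asm) integrable_completion) (auto simp: mult.commute)
        show "integrable lborel (\<lambda>z::real^'n. B * gauss z)"
          using integrable_gauss by auto
        show "norm (complex_of_real (gauss z) * h (x + \<delta> k *\<^sub>R z)) \<le> B * gauss z" for z
          using B by (auto simp: norm_mult less_imp_le[OF gauss_pos] mult.commute[of B] intro!: mult_left_mono AE_I2)
      qed
      then show ?thesis by (simp add: G)
    qed
    have [measurable]: "I k \<in> borel_measurable borel" for k
      unfolding I_def by measurable
    have [measurable]: "I k \<in> borel_measurable lebesgue" for k
      by (rule measurable_completion) simp
    have [measurable]: "h \<in> borel_measurable lebesgue"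
      by (rule measurable_completion) simp
    have "(\<lambda>k. \<integral>x. g x * I k x \<partial>lebesgue) \<longlonglongrightarrow> (\<integral>x. g x * (complex_of_real G * h x) \<partial>lebesgue)"
    proof (rule integral_dominated_convergence[where w="\<lambda>x. cmod (g x) * (B * G)"])
      show "AE x in lebesgue. (\<lambda>k. g x * I k x) \<longlonglongrightarrow> g x * (complex_of_real G * h x)"
        by (intro AE_I2 tendsto_intros Ilim)
      show "AE x in lebesgue. norm (g x * I k x) \<le> cmod (g x) * (B * G)" for k
        by (auto simp: norm_mult intro!: mult_left_mono Ibd)
    qed (use g in auto)
    then have "(\<integral>x. complex_of_real G * (g x * h x) \<partial>lebesgue) = 0"
      unfolding I0 by (auto simp: LIMSEQ_const_iff mult_ac)
    moreover have "G \<noteq> 0" by (simp add: G_def)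
    ultimately show ?thesis by simp
  qed
  \<comment> \<open>Chosen so that \<open>g x * \<sigma> x = cmod (g x)\<close>.\<close>
  define \<sigma> where "\<sigma> x = sgn (cnj (g x))" for x
  have [measurable]: "cnj \<in> borel_measurable borel"
    by (intro borel_measurable_continuous_onI continuous_intros)
  have [measurable]: "\<sigma> \<in> borel_measurable lebesgue"
    unfolding \<sigma>_def sgn_div_norm by measurable
  have "\<sigma> measurable_on UNIV"
    by (rule lebesgue_measurable_imp_measurable_on) auto
  then obtain N f where N: "negligible N" and f: "\<And>k. continuous_on UNIV (f k)"
    and lim: "\<And>x. x \<notin> N \<Longrightarrow> (\<lambda>k. f k x) \<longlonglongrightarrow> \<sigma> x"
    unfolding measurable_on_def by auto
  \<comment> \<open>The approximants \<open>f k\<close> may be unbounded. Dividing by the maximum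
    confines them to the unit disc without changing the limit, as
    \<open>cmod (\<sigma> x) \<le> 1\<close>; the factor \<open>gauss\<close> makes them
    integrable.\<close>
  define h where "h k x = f k x / complex_of_real (max 1 (cmod (f k x))) * complex_of_real (gauss x)" for k x
  have ch: "continuous_on UNIV (\<lambda>x. f k x / complex_of_real (max 1 (cmod (f k x))))" for k
    by (intro continuous_intros f) auto
  have bh: "cmod (f k x / complex_of_real (max 1 (cmod (f k x)))) \<le> 1" for k x
    by (simp add: norm_divide)
  have ih: "integrable lebesgue (h k)" for k
    using integrable_lebesgue_gauss_modulated[OF ch bh, of 1 _ 0] by (simp add: h_def[abs_def])
  have ch': "continuous_on UNIV (h k)" for k
    unfolding h_def by (intro continuous_on_mult ch continuous_intros)
  have bh': "cmod (h k x) \<le> 1" for k x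
    unfolding h_def norm_mult using bh[of k x] gauss_le_1[of x] gauss_pos[of x]
    by (intro mult_le_one) auto
  have [measurable]: "h k \<in> borel_measurable lebesgue" for k
    using ih by auto
  have [measurable]: "(\<lambda>x::real^'n. gauss x) \<in> borel_measurable lebesgue"
    by (rule measurable_completion) simp
  have AEN: "AE x in lebesgue. x \<notin> N"
    using N by (auto simp: negligible_iff_null_sets intro: AE_not_in)
  have "(\<lambda>k. \<integral>x. g x * h k x \<partial>lebesgue) \<longlonglongrightarrow> (\<integral>x. g x * (\<sigma> x * complex_of_real (gauss x)) \<partial>lebesgue)"
  proof (rule integral_dominated_convergence[where w="\<lambda>x. cmod (g x)"])
    show "AE x in lebesgue. (\<lambda>k. g x * h k x) \<longlonglongrightarrow> g x * (\<sigma> x * complex_of_real (gauss x))"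
      using AEN
    proof eventually_elim
      case (elim x)
      have "max 1 (cmod (\<sigma> x)) = 1"
        by (simp add: \<sigma>_def norm_sgn)
      then have "(\<lambda>k. h k x) \<longlonglongrightarrow> \<sigma> x / complex_of_real 1 * complex_of_real (gauss x)"
        unfolding h_def by (intro tendsto_intros lim elim tendsto_eq_rhs[OF tendsto_max[OF tendsto_const tendsto_norm[OF lim[OF elim]]]]) auto
      then show ?case by (auto intro!: tendsto_intros)
    qed
    show "AE x in lebesgue. norm (g x * h k x) \<le> cmod (g x)" for k
      using mult_left_mono[OF bh' norm_ge_zero] by (auto simp: norm_mult)
  qed (use g in auto)
  then have "(\<integral>x. g x * (\<sigma> x * complex_of_real (gauss x)) \<partial>lebesgue) = 0"
    unfolding cont0[OF ch' ih bh'] by (auto simp: LIMSEQ_const_iff)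
  moreover have eq: "g x * (\<sigma> x * complex_of_real (gauss x)) = complex_of_real (cmod (g x) * gauss x)" for x
  proof -
    have "g x * \<sigma> x = complex_of_real (cmod (g x))"
      by (cases "g x = 0") (auto simp: \<sigma>_def sgn_eq complex_norm_square[symmetric] power2_eq_square)
    then show ?thesis by (simp flip: mult.assoc)
  qed
  ultimately have z: "(\<integral>x. cmod (g x) * gauss x \<partial>lebesgue) = 0"
    unfolding eq integral_complex_of_real of_real_eq_0_iff by simp
  have "integrable lebesgue (\<lambda>x. cmod (g x) * gauss x)"
    by (rule Bochner_Integration.integrable_bound[OF integrable_norm[OF g]])
       (auto simp: gauss_le_1 abs_mult less_imp_le[OF gauss_pos] mult_left_le)
  then have "AE x in lebesgue. cmod (g x) * gauss x = 0"
    using z by (subst (asm) integral_nonneg_eq_0_iff_AE) (auto simp: less_imp_le[OF gauss_pos])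
  then show ?thesis
    by eventually_elim (use gauss_pos in \<open>auto simp: less_le\<close>)
qed

subsection \<open>Entire functions related by a fractional power\<close>

text \<open>Continue \<open>z powr (2 * s) * f z + F z\<close> from the positive to the negative
  reals through the upper half plane, using the branch of the logarithm cut along the negative
  imaginary axis: at \<open>-1\<close> the factor becomes \<open>exp (2 * pi * \<i> * s)\<close>, which differs from 1.\<close>
lemma entire_powr_monodromy:
  assumes f: "f holomorphic_on UNIV" and F: "F holomorphic_on UNIV" and s: "0 < s" "s < 1"
    and pos: "\<And>t. t > 0 \<Longrightarrow> complex_of_real (t powr (2 * s)) * f (complex_of_real t) + F (complex_of_real t) = 0"
    and neg: "f (- 1) + F (- 1) = 0"
  shows "f (- 1) = 0"
proof -
  define S where "S = {z. - \<i> * z \<notin> \<real>\<^sub>\<le>\<^sub>0}"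
  \<comment> \<open>The rotated logarithm: it is \<open>ln t\<close> at positive t, and turning
    counterclockwise to -1 it takes the value \<open>\<i> * pi\<close>.\<close>
  define L where "L z = Ln (- \<i> * z) + \<i> * (pi / 2)" for z
  define H where "H z = exp (2 * s * L z) * f z + F z" for z
  \<comment> \<open>A quarter turn of the starlike slotted plane, which gives connectedness of
    \<open>S\<close>.\<close>
  have S_eq: "S = (\<lambda>z. \<i> * z) ` (- (complex_of_real ` {..0}))"
  proof -
    have mem: "z \<in> S \<longleftrightarrow> - \<i> * z \<in> - (complex_of_real ` {..0})" for z
      by (auto simp: S_def nonpos_Reals_def)
    show ?thesis
    proof (intro equalityI subsetI)
      fix z assume "z \<in> S"
      then show "z \<in> (\<lambda>z. \<i> * z) ` (- (complex_of_real ` {..0}))"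
        unfolding mem by (rule image_eqI[rotated]) (simp flip: mult.assoc)
    next
      fix z assume "z \<in> (\<lambda>z. \<i> * z) ` (- (complex_of_real ` {..0}))"
      then obtain w where "w \<in> - (complex_of_real ` {..0})" "z = \<i> * w" by blast
      moreover have "- \<i> * (\<i> * w) = w" by (simp flip: mult.assoc)
      ultimately show "z \<in> S" unfolding mem by simp
    qed
  qed
  have "connected S"
    unfolding S_eq
    by (intro connected_continuous_image starlike_imp_connected starlike_slotted_complex_plane_left continuous_intros)
  moreover have "open S"
  proof -
    have "S = (\<lambda>z. - \<i> * z) -` (- \<real>\<^sub>\<le>\<^sub>0)" by (auto simp: S_def)
    moreover have "open ((\<lambda>z. - \<i> * z) -` (- \<real>\<^sub>\<le>\<^sub>0))"
      by (intro open_vimage continuous_intros) (auto simp: closed_nonpos_Reals_complex)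
    ultimately show ?thesis by simp
  qed
  moreover have "H holomorphic_on S"
    unfolding H_def L_def
    by (intro holomorphic_intros holomorphic_on_subset[OF f] holomorphic_on_subset[OF F]) (auto simp: S_def)
  moreover have posS: "complex_of_real ` {0<..} \<subseteq> S"
    by (auto simp: S_def complex_nonpos_Reals_iff)
  moreover have "(1::complex) islimpt complex_of_real ` {0<..}"
  proof -
    have "(1::real) islimpt {0<..}"
      by (rule interior_limit_point) (simp add: interior_open)
    then show ?thesis
      using islimpt_isCont_image[of "1::real" "{0<..}" complex_of_real]
      by (auto simp: eventually_at_filter)
  qed
  moreover have "1 \<in> S" "- 1 \<in> S"
    by (auto simp: S_def complex_nonpos_Reals_iff)
  moreover have "H z = 0" if "z \<in> complex_of_real ` {0<..}" for z
  proof -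
    obtain t where t: "t > 0" "z = complex_of_real t" using \<open>z \<in> _\<close> by auto
    have "Ln (complex_of_real t * - \<i>) = ln t + Ln (- \<i>)"
      using t(1) by (metis Ln_of_real Ln_times_of_real complex_i_not_zero neg_equal_0_iff_equal)
    then have "L z = ln t"
      by (simp add: L_def t mult.commute)
    then show ?thesis
      using pos[OF t(1)] t by (simp add: H_def powr_def exp_of_real[symmetric] mult_ac)
  qed
  ultimately have "H (- 1) = 0"
    using analytic_continuation[of H S "complex_of_real ` {0<..}" 1 "- 1"] by blast
  moreover have "L (- 1) = \<i> * pi"
    by (simp add: L_def)
  \<comment> \<open>Both sides equal \<open>- F (- 1)\<close>: the left by continuation, the right
    by the relation \<open>neg\<close> on the real line.\<close>
  ultimately have "exp (2 * s * (\<i> * pi)) * f (- 1) = f (- 1)"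
    using neg by (simp add: H_def add_eq_0_iff)
  moreover have "exp (2 * s * (\<i> * pi)) \<noteq> 1"
  proof
    assume "exp (2 * s * (\<i> * pi)) = 1"
    then obtain n :: int where "2 * s * pi = of_int (2 * n) * pi"
      unfolding exp_eq_1 by auto
    then have "s = of_int n" by simp
    then show False using s by simp
  qed
  ultimately show ?thesis by simp
qed

subsection \<open>Fourier transforms under fast decay\<close>

text \<open>Expanding the exponential and integrating term by term gives a power series that
  converges at every z. All partial sums are dominated by
  \<open>exp (cmod z * norm \<eta> * norm x) * cmod (v x)\<close>, hence the need for every
  R.\<close>

lemma holomorphic_fourier_line:
  fixes v :: "'a::euclidean_space \<Rightarrow> complex"
  assumes m [measurable]: "v \<in> borel_measurable lebesgue"
    and v: "\<And>R. integrable lebesgue (\<lambda>x. exp (R * norm x) * cmod (v x))"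
  shows "(\<lambda>z. \<integral>x. exp (- (\<i> * z * complex_of_real (x \<bullet> \<eta>))) * v x \<partial>lebesgue) holomorphic_on UNIV"
proof -
  define f where "f z = (\<integral>x. exp (- (\<i> * z * complex_of_real (x \<bullet> \<eta>))) * v x \<partial>lebesgue)" for z
  define a where "a k = (\<integral>x. (- \<i> * complex_of_real (x \<bullet> \<eta>)) ^ k / fact k * v x \<partial>lebesgue)" for k
  have [measurable]: "(\<lambda>x::'a. complex_of_real (x \<bullet> \<eta>)) \<in> borel_measurable lebesgue"
    by (intro measurable_completion) simp
  have sums: "(\<lambda>k. a k * z ^ k) sums f z" for z
  proof -
    define w where "w x = - (\<i> * z * complex_of_real (x \<bullet> \<eta>))" for x
    have [measurable]: "w \<in> borel_measurable lebesgue" unfolding w_def by measurable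
    have part: "norm (\<Sum>k<m. w x ^ k / fact k) \<le> exp (cmod z * norm \<eta> * norm x)" for m x
    proof -
      have "norm (w x) \<le> cmod z * norm \<eta> * norm x"
        using mult_left_mono[OF Cauchy_Schwarz_ineq2[of x \<eta>] norm_ge_zero[of z]]
        by (simp add: w_def norm_mult mult_ac)
      moreover have "norm (\<Sum>k<m. w x ^ k / fact k) \<le> (\<Sum>k<m. norm (w x) ^ k / fact k)"
        by (rule order_trans[OF norm_sum]) (simp add: norm_divide norm_power)
      moreover have "(\<Sum>k<m. norm (w x) ^ k / fact k) \<le> exp (norm (w x))"
        unfolding exp_def using summable_exp[of "norm (w x)"]
        by (intro order_trans[OF sum_le_suminf[of "\<lambda>k. norm (w x) ^ k / fact k" "{..<m}"]])
           (auto simp: divide_inverse_commute scaleR_conv_of_real)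
      ultimately show ?thesis by (meson exp_le_cancel_iff order_trans)
    qed
    have termI: "integrable lebesgue (\<lambda>x. w x ^ k / fact k * v x)" for k
    proof (rule Bochner_Integration.integrable_bound)
      \<comment> \<open>The factor 2 arises because a single term is the difference of two partial
        sums, each bounded by \<open>part\<close>.\<close>
      show "integrable lebesgue (\<lambda>x. 2 * (exp ((cmod z * norm \<eta>) * norm x) * cmod (v x)))"
        by (intro integrable_mult_right v)
      show "AE x in lebesgue. norm (w x ^ k / fact k * v x) \<le> norm (2 * (exp ((cmod z * norm \<eta>) * norm x) * cmod (v x)))"
      proof (rule AE_I2)
        fix x
        have "norm (w x ^ k / fact k) \<le> norm (\<Sum>j<Suc k. w x ^ j / fact j) + norm (\<Sum>j<k. w x ^ j / fact j)"
          using norm_triangle_ineq4[of "\<Sum>j<Suc k. w x ^ j / fact j" "\<Sum>j<k. w x ^ j / fact j"] by simp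
        then have "norm (w x ^ k / fact k) \<le> 2 * exp (cmod z * norm \<eta> * norm x)"
          using part[of x "Suc k"] part[of x k] by linarith
        from mult_right_mono[OF this norm_ge_zero[of "v x"]]
        show "norm (w x ^ k / fact k * v x) \<le> norm (2 * (exp ((cmod z * norm \<eta>) * norm x) * cmod (v x)))"
          by (simp add: norm_mult norm_divide)
      qed
    qed measurable
    have a: "a k * z ^ k = (\<integral>x. w x ^ k / fact k * v x \<partial>lebesgue)" for k
      unfolding a_def w_def
      by (subst integral_mult_left_zero[symmetric]) (simp add: power_mult_distrib mult_ac flip: power_mult_distrib)
    have "(\<lambda>m. \<integral>x. (\<Sum>k<m. w x ^ k / fact k) * v x \<partial>lebesgue) \<longlonglongrightarrow> (\<integral>x. exp (w x) * v x \<partial>lebesgue)"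
    proof (rule integral_dominated_convergence)
      show "integrable lebesgue (\<lambda>x. exp ((cmod z * norm \<eta>) * norm x) * cmod (v x))" by (rule v)
      show "AE x in lebesgue. (\<lambda>m. (\<Sum>k<m. w x ^ k / fact k) * v x) \<longlonglongrightarrow> exp (w x) * v x"
      proof (rule AE_I2)
        fix x
        have "(\<lambda>k. w x ^ k / fact k) sums exp (w x)"
          using exp_converges[of "w x"] by (simp add: scaleR_conv_of_real divide_inverse mult.commute)
        then show "(\<lambda>m. (\<Sum>k<m. w x ^ k / fact k) * v x) \<longlonglongrightarrow> exp (w x) * v x"
          unfolding sums_def by (intro tendsto_intros)
      qed
      show "AE x in lebesgue. norm ((\<Sum>k<m. w x ^ k / fact k) * v x) \<le> exp ((cmod z * norm \<eta>) * norm x) * cmod (v x)" for m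
        using part by (auto simp: norm_mult intro!: mult_right_mono)
    qed measurable
    moreover have "(\<Sum>k<m. a k * z ^ k) = (\<integral>x. (\<Sum>k<m. w x ^ k / fact k) * v x \<partial>lebesgue)" for m
      unfolding a sum_distrib_right by (intro Bochner_Integration.integral_sum[symmetric] termI)
    ultimately show ?thesis
      unfolding sums_def f_def w_def by simp
  qed
  have "f holomorphic_on ball 0 r" for r
    by (rule power_series_holomorphic[of 0 r a]) (use sums in simp)
  then have "f holomorphic_on (\<Union>r. ball 0 r)"
    by (intro holomorphic_on_UN_open) auto
  moreover have "(\<Union>r. ball 0 r) = (UNIV :: complex set)"
    by (auto intro: gt_ex)
  ultimately show ?thesis by (simp add: f_def[abs_def])
qed

section \<open>Exponential integrability from the decay hypothesis\<close>

lemma integrable_exp_minus_abs: "integrable lborel (\<lambda>t::real. exp (- \<bar>t\<bar>))"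
proof -
  have 1: "integrable lborel (\<lambda>t::real. indicator {0<..} t * exp (- t))"
    using integrable_I0i_exp_mscale[of 1] by (simp add: set_integrable_def)
  have 2: "integrable lborel (\<lambda>t::real. indicator {0<..} (- t) * exp t)"
    using lborel_integrable_real_affine[OF 1, of "- 1" 0] by simp
  have "integrable lborel (\<lambda>t::real. indicator {0<..} t * exp (- t) + indicator {0<..} (- t) * exp t)"
    by (intro Bochner_Integration.integrable_add 1 2)
  then show ?thesis
    by (rule integrable_cong_AE_imp)
       (auto intro!: AE_I'[of "{0}"] split: split_indicator)
qed

text \<open>The rate \<open>DIM('a)\<close> comes from bounding the sum of the coordinates' absolute
  values by \<open>DIM('a) * norm x\<close>, which leaves a product of one-dimensional
  exponentials.\<close>

lemma integrable_exp_minus_norm: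
  "integrable lborel (\<lambda>x::'a::euclidean_space. exp (- (real DIM('a) * norm x)))"
proof (rule Bochner_Integration.integrable_bound)
  show "integrable lborel (\<lambda>x::'a. \<Prod>b\<in>Basis. exp (- \<bar>x \<bullet> b\<bar>))"
    by (rule integrable_prod_Basis(1)) (rule integrable_exp_minus_abs)
  have "(\<Sum>b\<in>Basis. \<bar>x \<bullet> b\<bar>) \<le> real DIM('a) * norm x" for x :: 'a
    using sum_bounded_above[of "Basis::'a set" "\<lambda>b. \<bar>x \<bullet> b\<bar>" "norm x"] by (simp add: Basis_le_norm)
  then show "AE x::'a in lborel. norm (exp (- (real DIM('a) * norm x))) \<le> norm (\<Prod>b\<in>Basis. exp (- \<bar>x \<bullet> b\<bar>))"
    by (simp add: exp_sum[symmetric] sum_negf)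
qed simp

text \<open>Splitting the weight in half and using \<open>a * b \<le> a\<^sup>2 + b\<^sup>2\<close>
  leaves the hypothesis plus \<open>exp (2 * R * norm x - norm x powr \<alpha>)\<close>, and
  \<alpha> > 1 beats every linear exponent.\<close>

lemma integrable_exp_of_superexponential_decay:
  fixes u :: "'a::euclidean_space \<Rightarrow> complex"
  assumes m [measurable]: "u \<in> borel_measurable lebesgue" and \<alpha>: "\<alpha> > 1"
    and fin: "(\<integral>\<^sup>+ x. ennreal (exp (norm x powr \<alpha>) * (cmod (u x))\<^sup>2) \<partial>lebesgue) < \<infinity>"
  shows "integrable lebesgue (\<lambda>x. exp (R * norm x) * cmod (u x))"
proof -
  have [measurable]: "(\<lambda>x::'a. norm x) \<in> borel_measurable lebesgue"
    by (intro measurable_completion) simp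
  define A where "A = max 1 (2 * R + real DIM('a))"
  \<comment> \<open>\<open>A powr (1 / (\<alpha> - 1))\<close> is the radius at which
    \<open>A * r = r powr \<alpha>\<close>. Below it \<open>A * r\<close> is at most
    \<open>M\<close>, above it at most \<open>r powr \<alpha>\<close>. The extra
    \<open>DIM('a)\<close> in \<open>A\<close> saves an integrable factor.\<close>
  define M where "M = A * A powr (1 / (\<alpha> - 1))"
  have M: "2 * R * r - r powr \<alpha> \<le> M - real DIM('a) * r" if "r \<ge> 0" for r
  proof -
    have "(2 * R + real DIM('a)) * r \<le> A * r"
      by (intro mult_right_mono that) (simp add: A_def)
    moreover have "A * r \<le> M + r powr \<alpha>"
    proof (cases "r \<le> A powr (1 / (\<alpha> - 1))")
      case True
      then have "A * r \<le> M" unfolding M_def by (intro mult_left_mono) (auto simp: A_def)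
      then show ?thesis by (smt (verit) powr_ge_zero)
    next
      case False
      have "A = (A powr (1 / (\<alpha> - 1))) powr (\<alpha> - 1)"
        using \<alpha> by (simp add: powr_powr A_def)
      also have "\<dots> \<le> r powr (\<alpha> - 1)"
        using False \<alpha> by (intro powr_mono2) auto
      finally have "A * r \<le> r powr (\<alpha> - 1) * r"
        by (intro mult_right_mono that)
      also have "\<dots> = r powr \<alpha>"
        using False that by (cases "r = 0") (auto simp: powr_diff)
      finally show ?thesis by (smt (verit) A_def M_def mult_nonneg_nonneg powr_ge_zero)
    qed
    ultimately show ?thesis by (simp add: algebra_simps)
  qed
  have 1: "integrable lebesgue (\<lambda>x. exp (norm x powr \<alpha>) * (cmod (u x))\<^sup>2)"
    using fin by (intro integrableI_bounded) auto
  have 2: "integrable lebesgue (\<lambda>x::'a. exp M * exp (- (real DIM('a) * norm x)))"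
    by (intro integrable_mult_right) (simp add: integrable_completion integrable_exp_minus_norm)
  show ?thesis
  proof (rule Bochner_Integration.integrable_bound[OF Bochner_Integration.integrable_add[OF 1 2]])
    show "AE x in lebesgue. norm (exp (R * norm x) * cmod (u x)) \<le>
      norm (exp (norm x powr \<alpha>) * (cmod (u x))\<^sup>2 + exp M * exp (- (real DIM('a) * norm x)))"
    proof (rule AE_I2)
      fix x :: 'a
      let ?p = "norm x powr \<alpha>"
      have am: "a * b \<le> a\<^sup>2 + b\<^sup>2" if "a \<ge> 0" "b \<ge> 0" for a b :: real
        using sum_squares_bound[of a b] mult_nonneg_nonneg[OF that] by linarith
      have sq: "(exp t)\<^sup>2 = exp (2 * t)" for t :: real by (simp add: exp_double)
      have "exp (R * norm x) * cmod (u x) = (exp (?p / 2) * cmod (u x)) * exp (R * norm x - ?p / 2)"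
        by (simp add: exp_diff)
      also have "\<dots> \<le> (exp (?p / 2) * cmod (u x))\<^sup>2 + (exp (R * norm x - ?p / 2))\<^sup>2"
        by (rule am) auto
      also have "\<dots> = exp ?p * (cmod (u x))\<^sup>2 + exp (2 * R * norm x - ?p)"
        by (simp add: power_mult_distrib sq algebra_simps)
      also have "\<dots> \<le> exp ?p * (cmod (u x))\<^sup>2 + exp M * exp (- (real DIM('a) * norm x))"
        using M[of "norm x"] by (simp add: exp_add[symmetric])
      finally show "norm (exp (R * norm x) * cmod (u x)) \<le>
        norm (exp ?p * (cmod (u x))\<^sup>2 + exp M * exp (- (real DIM('a) * norm x)))"
        by simp
    qed
  qed measurable
qed

section \<open>Transforms of integrable functions: duality, boundedness, continuity\<close>

lemma is_L2_fourier_fourier_L1: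
  assumes "integrable lebesgue \<phi>" "L2 (fourier_L1 \<phi>)"
  shows "is_L2_fourier \<phi> (fourier_L1 \<phi>)"
  using assms fourier_L1_multiplication[OF assms(1)] by (simp add: is_L2_fourier_def mult.commute)

lemma norm_fourier_L1_le: "cmod (fourier_L1 f \<xi>) \<le> (\<integral>x. cmod (f x) \<partial>lebesgue)"
  unfolding fourier_L1_def by (rule order_trans[OF integral_norm_bound]) (simp add: norm_mult)

lemma borel_measurable_cis_inner [measurable]:
  "(\<lambda>x. cis (- (x \<bullet> \<xi>))) \<in> borel_measurable (lebesgue :: 'a::euclidean_space measure)"
  by (intro measurable_completion) (simp, intro borel_measurable_continuous_onI continuous_intros)

lemma continuous_on_fourier_L1:
  assumes f: "integrable lebesgue f"
  shows "continuous_on UNIV (fourier_L1 f)"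
proof (rule continuous_on_sequentiallyI)
  fix \<xi> :: "nat \<Rightarrow> real^'a" and \<eta> assume lim: "\<xi> \<longlonglongrightarrow> \<eta>"
  have [measurable]: "f \<in> borel_measurable lebesgue" using f by auto
  show "(\<lambda>k. fourier_L1 f (\<xi> k)) \<longlonglongrightarrow> fourier_L1 f \<eta>"
    unfolding fourier_L1_def
  proof (rule integral_dominated_convergence[where w="\<lambda>x. cmod (f x)"])
    show "AE x in lebesgue. (\<lambda>k. cis (- (x \<bullet> \<xi> k)) * f x) \<longlonglongrightarrow> cis (- (x \<bullet> \<eta>)) * f x"
      by (intro AE_I2 tendsto_intros lim)
  qed (use f in \<open>auto simp: norm_mult\<close>)
qed

text \<open>The set where \<open>f\<close> is nonzero is open and negligible, hence empty.\<close>

lemma AE_eq_0_continuous: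
  fixes f :: "'a::euclidean_space \<Rightarrow> complex"
  assumes "continuous_on UNIV f" "AE x in lebesgue. f x = 0"
  shows "f x = 0"
proof -
  have o: "open {x. f x \<noteq> 0}"
    by (intro open_Collect_neq assms continuous_intros)
  then have "{x. f x \<noteq> 0} \<in> sets lebesgue"
    by (intro sets_completionI_sets) auto
  then have "negligible {x. f x \<noteq> 0}"
    using assms(2) AE_iff_null_sets[of "{x. f x \<noteq> 0}" lebesgue]
    by (auto simp: negligible_iff_null_sets)
  with o open_not_negligible show ?thesis by blast
qed

subsection \<open>The equation on the Fourier side\<close>

text \<open>A bounded integrable function is square integrable.\<close>

lemma L2_gauss_modulated:
  fixes f :: "real^'n \<Rightarrow> complex"
  assumes "continuous_on UNIV f" "\<And>x. cmod (f x) \<le> B" "c \<noteq> 0"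
  shows "L2 (\<lambda>x. f x * complex_of_real (gauss (c *\<^sub>R (x - y))))"
proof -
  let ?g = "\<lambda>x. f x * complex_of_real (gauss (c *\<^sub>R (x - y)))"
  have g: "integrable lebesgue ?g"
    by (rule integrable_lebesgue_gauss_modulated[OF assms])
  have le: "cmod (?g x) \<le> B" for x
    using mult_mono[OF assms(2) gauss_le_1[of "c *\<^sub>R (x - y)"]] order_trans[OF norm_ge_zero assms(2)]
    by (simp add: norm_mult less_imp_le[OF gauss_pos])
  have m: "(\<lambda>x. (cmod (?g x))\<^sup>2) \<in> borel_measurable lebesgue"
    using measurable_compose[OF borel_measurable_integrable[OF g] borel_measurable_norm]
    by (rule borel_measurable_power)
  have "integrable lebesgue (\<lambda>x. B * cmod (?g x))"
    by (intro integrable_mult_right integrable_norm g)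
  then have "integrable lebesgue (\<lambda>x. (cmod (?g x))\<^sup>2)"
  proof (rule Bochner_Integration.integrable_bound[OF _ m], intro AE_I2)
    fix x
    have "cmod (?g x) * cmod (?g x) \<le> \<bar>B\<bar> * cmod (?g x)"
      by (intro mult_right_mono order_trans[OF le abs_ge_self] norm_ge_zero)
    then show "norm ((cmod (?g x))\<^sup>2) \<le> norm (B * cmod (?g x))"
      by (simp only: power2_eq_square real_norm_def abs_mult abs_norm_cancel)
  qed
  with borel_measurable_integrable[OF g] show ?thesis
    unfolding L2_def by blast
qed

text \<open>For s < 1 the weight is at most \<open>1 + (norm \<xi>)\<^sup>2\<close>, hence at most
  \<open>2 * exp ((norm \<xi>)\<^sup>2 / 2)\<close>, which cancels one of the two Gaussian
  factors.\<close>

lemma integrable_weighted_gauss: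
  assumes "s < 1"
  shows "integrable lebesgue (\<lambda>\<xi>::'a::euclidean_space. (1 + (norm \<xi>)\<^sup>2) powr s * (gauss \<xi>)\<^sup>2)"
proof -
  have m: "(\<lambda>\<xi>::'a. (1 + (norm \<xi>)\<^sup>2) powr s * (gauss \<xi>)\<^sup>2) \<in> borel_measurable borel"
    by measurable
  have "integrable lborel (\<lambda>\<xi>::'a. (1 + (norm \<xi>)\<^sup>2) powr s * (gauss \<xi>)\<^sup>2)"
  proof (rule Bochner_Integration.integrable_bound)
    show "integrable lborel (\<lambda>\<xi>::'a. 2 * gauss \<xi>)"
      by (intro integrable_mult_right integrable_gauss)
    show "AE \<xi>::'a in lborel. norm ((1 + (norm \<xi>)\<^sup>2) powr s * (gauss \<xi>)\<^sup>2) \<le> norm (2 * gauss \<xi>)"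
    proof (rule AE_I2)
      fix \<xi> :: 'a
      have "(1 + (norm \<xi>)\<^sup>2) powr s \<le> (1 + (norm \<xi>)\<^sup>2) powr 1"
        using assms by (intro powr_mono) auto
      also have "\<dots> \<le> 2 * exp ((norm \<xi>)\<^sup>2 / 2)"
      proof -
        have "1 + (norm \<xi>)\<^sup>2 \<le> 2 * exp ((norm \<xi>)\<^sup>2 / 2)"
          using exp_ge_add_one_self[of "(norm \<xi>)\<^sup>2 / 2"] by linarith
        then show ?thesis by simp
      qed
      finally have "(1 + (norm \<xi>)\<^sup>2) powr s * (gauss \<xi>)\<^sup>2 \<le> 2 * exp ((norm \<xi>)\<^sup>2 / 2) * (gauss \<xi>)\<^sup>2"
        by (rule mult_right_mono) simp
      also have "\<dots> = 2 * gauss \<xi>"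
        by (simp add: gauss_def power2_eq_square exp_add[symmetric] flip: exp_double)
      finally show "norm ((1 + (norm \<xi>)\<^sup>2) powr s * (gauss \<xi>)\<^sup>2) \<le> norm (2 * gauss \<xi>)"
        by (simp add: less_imp_le[OF gauss_pos])
    qed
  qed (use m in simp)
  with m show ?thesis by (simp add: integrable_completion)
qed

lemma Hs_gauss_translated:
  fixes y :: "real^'n"
  assumes "s < 1"
  shows "Hs s (\<lambda>x. complex_of_real (gauss (x - y)))"
    and "is_L2_fourier (\<lambda>x. complex_of_real (gauss (x - y))) (fourier_L1 (\<lambda>x. complex_of_real (gauss (x - y))))"
proof -
  let ?\<phi> = "\<lambda>x. complex_of_real (gauss (x - y))"
  define G where "G = sqrt (2 * pi) ^ CARD('n)"
  have G: "G > 0" by (simp add: G_def)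
  \<comment> \<open>The trivial scaling and shift put the transform into the shape of
    \<open>L2_gauss_modulated\<close>.\<close>
  have F: "fourier_L1 ?\<phi> = (\<lambda>\<xi>. complex_of_real G * cis (- (y \<bullet> \<xi>)) * complex_of_real (gauss (1 *\<^sub>R (\<xi> - 0))))"
    by (rule ext, subst fourier_L1_gauss_translated) (simp add: G_def)
  have "L2 (\<lambda>\<xi>. complex_of_real G * cis (- (y \<bullet> \<xi>)) * complex_of_real (gauss (1 *\<^sub>R (\<xi> - 0))))"
    by (rule L2_gauss_modulated[where B=G]) (use G in \<open>auto simp: norm_mult intro!: continuous_intros\<close>)
  then have L2F: "L2 (fourier_L1 ?\<phi>)" unfolding F .
  have c1: "continuous_on UNIV (\<lambda>_::real^'n. 1::complex)" by (rule continuous_on_const)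
  have "integrable lebesgue ?\<phi>" "L2 ?\<phi>"
    using integrable_lebesgue_gauss_modulated[OF c1, of 1 1 y] L2_gauss_modulated[OF c1, of 1 1 y] by auto
  then show *: "is_L2_fourier ?\<phi> (fourier_L1 ?\<phi>)"
    by (intro is_L2_fourier_fourier_L1 L2F)
  have "integrable lebesgue (\<lambda>\<xi>::real^'n. G\<^sup>2 * ((1 + (norm \<xi>)\<^sup>2) powr s * (gauss \<xi>)\<^sup>2))"
    by (intro integrable_mult_right integrable_weighted_gauss assms)
  then have "integrable lebesgue (\<lambda>\<xi>. (1 + (norm \<xi>)\<^sup>2) powr s * (cmod (fourier_L1 ?\<phi> \<xi>))\<^sup>2)"
    unfolding F by (simp add: norm_mult power_mult_distrib mult_ac)
  with * \<open>L2 ?\<phi>\<close> show "Hs s ?\<phi>"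
    unfolding Hs_def by blast
qed

text \<open>Testing with translated Gaussians shows that the Fourier transform of
  \<open>(norm \<xi> powr (2 * s) * U \<xi> + fourier_L1 (q u) \<xi>) * gauss \<xi>\<close> vanishes identically.\<close>
lemma weak_frac_schroedinger_fourier:
  fixes u :: "real^'n \<Rightarrow> complex"
  assumes s: "0 < s" "s < 1" and u_Hs: "Hs s u" and sol: "weak_frac_schroedinger s q u"
    and u: "integrable lebesgue u" and v: "integrable lebesgue (\<lambda>x. complex_of_real (q x) * u x)"
  shows "complex_of_real (norm \<xi> powr (2 * s)) * fourier_L1 u \<xi> + fourier_L1 (\<lambda>x. complex_of_real (q x) * u x) \<xi> = 0"
proof -
  define v where "v x = complex_of_real (q x) * u x" for x
  have v: "integrable lebesgue v" using v by (simp add: v_def[abs_def])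
  define P where "P \<xi> = complex_of_real (norm \<xi> powr (2 * s))" for \<xi> :: "real^'n"
  define \<gamma> where "\<gamma> \<xi> = complex_of_real (gauss \<xi>)" for \<xi> :: "real^'n"
  define G where "G = sqrt (2 * pi) ^ CARD('n)"
  have G: "G > 0" by (simp add: G_def)
  \<comment> \<open>This identity cancels the Plancherel constant in the weak formulation.\<close>
  have G2: "G * G = (2 * pi) ^ CARD('n)" unfolding G_def power_mult_distrib[symmetric] by simp
  from u_Hs obtain U where UF: "is_L2_fourier u U"
    and UW: "integrable lebesgue (\<lambda>\<xi>. (1 + (norm \<xi>)\<^sup>2) powr s * (cmod (U \<xi>))\<^sup>2)"
    unfolding Hs_def by blast
  have [measurable]: "U \<in> borel_measurable lebesgue"
    using UF unfolding is_L2_fourier_def L2_def by blast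
  have [measurable]: "P \<in> borel_measurable lebesgue" "\<gamma> \<in> borel_measurable lebesgue"
    unfolding P_def \<gamma>_def by (intro measurable_completion; simp)+

  \<comment> \<open>The Fourier kernel at y times \<open>gauss\<close>: integrating h against
    \<open>\<psi> y\<close> is the transform of \<open>h * \<gamma>\<close> at y, and
    \<open>\<psi> y\<close> is admissible in \<open>is_L2_fourier\<close>.\<close>
  define \<psi> where "\<psi> y \<xi> = cis (\<xi> \<bullet> (- y)) * complex_of_real (gauss (1 *\<^sub>R \<xi>))" for y \<xi> :: "real^'n"
  have cc: "continuous_on UNIV (\<lambda>\<xi>. cis (\<xi> \<bullet> (- y)))" for y :: "real^'n"
    by (intro continuous_intros)
  have \<psi>I: "integrable lebesgue (\<psi> y)" for y
    using integrable_lebesgue_gauss_modulated[OF cc[of y], of 1 1 0] by (simp add: \<psi>_def[abs_def])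
  have \<psi>2: "L2 (\<psi> y)" for y
    using L2_gauss_modulated[OF cc[of y], of 1 1 0] by (simp add: \<psi>_def[abs_def])
  have \<psi>F: "fourier_L1 (\<psi> y) = (\<lambda>x. complex_of_real G * complex_of_real (gauss (1 *\<^sub>R (x - (- y)))))" for y
    unfolding \<psi>_def by (rule ext, subst fourier_L1_gauss_modulated) (simp_all add: G_def)
  have \<psi>F2: "L2 (fourier_L1 (\<psi> y))" for y
    unfolding \<psi>F by (rule L2_gauss_modulated[where B=G]) (use G in auto)
  have \<psi>_eq: "cis (- (\<xi> \<bullet> y)) * (h * \<gamma> \<xi>) = h * \<psi> y \<xi>" for h y \<xi>
    by (simp add: \<psi>_def \<gamma>_def)
  have F\<psi>: "fourier_L1 (\<lambda>\<xi>. h \<xi> * \<gamma> \<xi>) y = (\<integral>\<xi>. h \<xi> * \<psi> y \<xi> \<partial>lebesgue)" for h y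
    unfolding fourier_L1_def \<psi>_eq ..

  \<comment> \<open>Applied with \<open>W = P\<close> and \<open>W = 1\<close>; the product
    \<open>cmod (U \<xi>) * gauss \<xi>\<close> is split into squares, both integrable against the
    Sobolev weight.\<close>
  have bound: "integrable lebesgue (\<lambda>\<xi>. W \<xi> * U \<xi> * \<gamma> \<xi>)"
    if W: "W \<in> borel_measurable lebesgue" "\<And>\<xi>. cmod (W \<xi>) \<le> (1 + (norm \<xi>)\<^sup>2) powr s" for W
  proof (rule Bochner_Integration.integrable_bound[OF Bochner_Integration.integrable_add[OF UW integrable_weighted_gauss[OF s(2)]]])
    show "(\<lambda>\<xi>. W \<xi> * U \<xi> * \<gamma> \<xi>) \<in> borel_measurable lebesgue" using W by simp
    show "AE \<xi> in lebesgue. norm (W \<xi> * U \<xi> * \<gamma> \<xi>) \<le>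
      norm ((1 + (norm \<xi>)\<^sup>2) powr s * (cmod (U \<xi>))\<^sup>2 + (1 + (norm \<xi>)\<^sup>2) powr s * (gauss \<xi>)\<^sup>2)"
    proof (rule AE_I2)
      fix \<xi>
      have "cmod (U \<xi>) * gauss \<xi> \<le> (cmod (U \<xi>))\<^sup>2 + (gauss \<xi>)\<^sup>2"
        using sum_squares_bound[of "cmod (U \<xi>)" "gauss \<xi>"]
          mult_nonneg_nonneg[OF norm_ge_zero[of "U \<xi>"] less_imp_le[OF gauss_pos[of \<xi>]]] by linarith
      then have "cmod (W \<xi>) * (cmod (U \<xi>) * gauss \<xi>) \<le> (1 + (norm \<xi>)\<^sup>2) powr s * ((cmod (U \<xi>))\<^sup>2 + (gauss \<xi>)\<^sup>2)"
        by (intro mult_mono W) (auto simp: less_imp_le[OF gauss_pos])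
      then show "norm (W \<xi> * U \<xi> * \<gamma> \<xi>) \<le>
          norm ((1 + (norm \<xi>)\<^sup>2) powr s * (cmod (U \<xi>))\<^sup>2 + (1 + (norm \<xi>)\<^sup>2) powr s * (gauss \<xi>)\<^sup>2)"
        by (simp add: norm_mult \<gamma>_def distrib_left less_imp_le[OF gauss_pos] mult.assoc)
    qed
  qed
  have "cmod (P \<xi>) \<le> (1 + (norm \<xi>)\<^sup>2) powr s" for \<xi>
  proof -
    have "norm \<xi> powr (2 * s) = ((norm \<xi>)\<^sup>2) powr s"
      by (cases "\<xi> = 0") (auto simp: powr_powr simp flip: powr_numeral)
    then show ?thesis using s by (auto simp: P_def intro!: powr_mono2)
  qed
  then have PU: "integrable lebesgue (\<lambda>\<xi>. P \<xi> * U \<xi> * \<gamma> \<xi>)"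
    by (intro bound) auto
  have U\<gamma>: "integrable lebesgue (\<lambda>\<xi>. U \<xi> * \<gamma> \<xi>)"
    using bound[of "\<lambda>_. 1"] s by (simp add: ge_one_powr_ge_zero)
  have F\<gamma>: "integrable lebesgue (\<lambda>\<xi>. fourier_L1 f \<xi> * \<gamma> \<xi>)" if f: "integrable lebesgue f" for f :: "real^'n \<Rightarrow> complex"
    using integrable_lebesgue_gauss_modulated[OF continuous_on_fourier_L1[OF f] norm_fourier_L1_le, of 1 0]
    by (simp add: \<gamma>_def)
  have mult\<psi>: "integrable lebesgue (\<lambda>\<xi>. h \<xi> * \<psi> y \<xi>)" if h: "integrable lebesgue (\<lambda>\<xi>. h \<xi> * \<gamma> \<xi>)" for h y
  proof -
    have [measurable]: "(\<lambda>\<xi>. h \<xi> * \<gamma> \<xi>) \<in> borel_measurable lebesgue" using h by auto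
    have "integrable lebesgue (\<lambda>\<xi>. cis (- (\<xi> \<bullet> y)) * (h \<xi> * \<gamma> \<xi>))"
      by (rule Bochner_Integration.integrable_bound[OF h]) (auto simp: norm_mult)
    then show ?thesis by (simp add: \<psi>_eq)
  qed

  \<comment> \<open>Identifies \<open>U\<close> with \<open>fourier_L1 u\<close> a.e.: the
    definition of \<open>U\<close> and the multiplication formula give the same pairing with each
    \<open>\<psi> y\<close>.\<close>
  have F0_1: "fourier_L1 (\<lambda>\<xi>. (U \<xi> - fourier_L1 u \<xi>) * \<gamma> \<xi>) y = 0" for y
  proof -
    have "fourier_L1 (\<lambda>\<xi>. (U \<xi> - fourier_L1 u \<xi>) * \<gamma> \<xi>) y = (\<integral>\<xi>. U \<xi> * \<psi> y \<xi> - fourier_L1 u \<xi> * \<psi> y \<xi> \<partial>lebesgue)"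
      using F\<psi>[of "\<lambda>\<xi>. U \<xi> - fourier_L1 u \<xi>" y] by (simp only: left_diff_distrib)
    also have "\<dots> = (\<integral>\<xi>. U \<xi> * \<psi> y \<xi> \<partial>lebesgue) - (\<integral>\<xi>. fourier_L1 u \<xi> * \<psi> y \<xi> \<partial>lebesgue)"
      by (intro Bochner_Integration.integral_diff mult\<psi> U\<gamma> F\<gamma> u)
    also have "(\<integral>\<xi>. U \<xi> * \<psi> y \<xi> \<partial>lebesgue) = (\<integral>x. u x * fourier_L1 (\<psi> y) x \<partial>lebesgue)"
      using UF \<psi>I \<psi>2 \<psi>F2 unfolding is_L2_fourier_def by blast
    also have "\<dots> = (\<integral>\<xi>. fourier_L1 u \<xi> * \<psi> y \<xi> \<partial>lebesgue)"
      using fourier_L1_multiplication[OF u \<psi>I] by (simp add: mult.commute)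
    finally show ?thesis by simp
  qed
  have I1: "integrable lebesgue (\<lambda>\<xi>. (U \<xi> - fourier_L1 u \<xi>) * \<gamma> \<xi>)"
    unfolding left_diff_distrib by (intro Bochner_Integration.integrable_diff U\<gamma> F\<gamma> u)
  have 1: "AE \<xi> in lebesgue. (U \<xi> - fourier_L1 u \<xi>) * \<gamma> \<xi> = 0"
    by (rule fourier_L1_inj[OF I1 AE_I2]) (rule F0_1)

  have F0_2: "fourier_L1 (\<lambda>\<xi>. (P \<xi> * U \<xi> + fourier_L1 v \<xi>) * \<gamma> \<xi>) y = 0" for y
  proof -
    \<comment> \<open>Centred at -y so that the conjugate of its transform is
      \<open>G * \<psi> y\<close>; conversely, \<open>G * \<phi>\<close> is the transform of
      \<open>\<psi> y\<close>.\<close>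
    define \<phi> where "\<phi> x = complex_of_real (gauss (x - (- y)))" for x
    define A where "A = (\<integral>\<xi>. P \<xi> * U \<xi> * \<psi> y \<xi> \<partial>lebesgue)"
    define B where "B = (\<integral>\<xi>. fourier_L1 v \<xi> * \<psi> y \<xi> \<partial>lebesgue)"
    have \<Phi>: "cnj (fourier_L1 \<phi> \<xi>) = complex_of_real G * \<psi> y \<xi>" for \<xi>
      unfolding \<phi>_def by (subst fourier_L1_gauss_translated)
        (simp add: \<psi>_def G_def cis_cnj inner_commute mult_ac)
    have weak: "complex_of_real (1 / (2 * pi) ^ CARD('n)) * (\<integral>\<xi>. P \<xi> * U \<xi> * cnj (fourier_L1 \<phi> \<xi>) \<partial>lebesgue)
        + (\<integral>x. complex_of_real (q x) * u x * cnj (\<phi> x) \<partial>lebesgue) = 0"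
      using sol UF Hs_gauss_translated[OF s(2), of "- y"]
      unfolding weak_frac_schroedinger_def P_def \<phi>_def[abs_def] by blast
    have XA: "(\<integral>\<xi>. P \<xi> * U \<xi> * cnj (fourier_L1 \<phi> \<xi>) \<partial>lebesgue) = complex_of_real G * A"
      unfolding \<Phi> A_def by (subst integral_mult_right_zero[symmetric]) (simp add: mult_ac)
    \<comment> \<open>The multiplication formula carries the potential term to the Fourier
      side.\<close>
    have YB: "complex_of_real G * (\<integral>x. complex_of_real (q x) * u x * cnj (\<phi> x) \<partial>lebesgue) = B"
    proof -
      have "complex_of_real G * (\<integral>x. complex_of_real (q x) * u x * cnj (\<phi> x) \<partial>lebesgue) = (\<integral>x. v x * fourier_L1 (\<psi> y) x \<partial>lebesgue)"
        by (subst integral_mult_right_zero[symmetric]) (simp add: \<psi>F v_def \<phi>_def mult_ac)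
      then show ?thesis
        unfolding B_def using fourier_L1_multiplication[OF v \<psi>I] by (simp add: mult.commute)
    qed
    have "complex_of_real G * (complex_of_real (1 / (G * G)) * (complex_of_real G * A)) + B = 0"
      using arg_cong[OF weak, of "\<lambda>z. complex_of_real G * z"]
      unfolding distrib_left XA YB G2 mult_zero_right .
    moreover have "complex_of_real G * (complex_of_real (1 / (G * G)) * (complex_of_real G * A)) = A"
      using G by (simp add: field_simps)
    ultimately have AB: "A + B = 0" by simp
    have "fourier_L1 (\<lambda>\<xi>. (P \<xi> * U \<xi> + fourier_L1 v \<xi>) * \<gamma> \<xi>) y = (\<integral>\<xi>. P \<xi> * U \<xi> * \<psi> y \<xi> + fourier_L1 v \<xi> * \<psi> y \<xi> \<partial>lebesgue)"
      using F\<psi>[of "\<lambda>\<xi>. P \<xi> * U \<xi> + fourier_L1 v \<xi>" y] by (simp only: distrib_right)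
    also have "\<dots> = A + B"
      unfolding A_def B_def by (intro Bochner_Integration.integral_add mult\<psi> PU F\<gamma> v)
    finally show ?thesis using AB by simp
  qed
  have I2: "integrable lebesgue (\<lambda>\<xi>. (P \<xi> * U \<xi> + fourier_L1 v \<xi>) * \<gamma> \<xi>)"
    unfolding distrib_right by (intro Bochner_Integration.integrable_add PU F\<gamma> v)
  have 2: "AE \<xi> in lebesgue. (P \<xi> * U \<xi> + fourier_L1 v \<xi>) * \<gamma> \<xi> = 0"
    by (rule fourier_L1_inj[OF I2 AE_I2]) (rule F0_2)

  have \<gamma>0: "\<gamma> \<xi> \<noteq> 0" for \<xi> using gauss_pos[of \<xi>] by (simp add: \<gamma>_def)
  have "AE \<xi> in lebesgue. P \<xi> * fourier_L1 u \<xi> + fourier_L1 v \<xi> = 0"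
    using 1 2 by eventually_elim (simp add: \<gamma>0)
  \<comment> \<open>Continuity of \<open>P\<close> at the origin uses s > 0. It turns the a.e.
    identity into one valid at each point of a given ray.\<close>
  moreover have "continuous_on UNIV (\<lambda>\<xi>. P \<xi> * fourier_L1 u \<xi> + fourier_L1 v \<xi>)"
    unfolding P_def using s
    by (intro continuous_intros continuous_on_fourier_L1 u v continuous_on_powr') auto
  ultimately have "P \<xi> * fourier_L1 u \<xi> + fourier_L1 v \<xi> = 0"
    by (intro AE_eq_0_continuous[of "\<lambda>\<xi>. P \<xi> * fourier_L1 u \<xi> + fourier_L1 v \<xi>"])
  then show ?thesis unfolding P_def v_def[abs_def] .
qed

section \<open>Continuation along each line and conclusion\<close>

theorem theorem1p1:
  fixes s :: real and q :: "real^'n \<Rightarrow> real" and u :: "real^'n \<Rightarrow> complex"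
  assumes s: "0 < s" "s < 1"
    and q_C1: "\<exists>Dq :: real^'n \<Rightarrow> real^'n. continuous_on UNIV Dq \<and>
                 (\<forall>x. (q has_derivative (\<lambda>h. Dq x \<bullet> h)) (at x)) \<and>
                 (\<forall>x. \<bar>x \<bullet> Dq x\<bar> \<le> 1)"
    and q_bd: "\<forall>x. \<bar>q x\<bar> \<le> 1"
    and u_Hs: "Hs s u"
    and sol: "weak_frac_schroedinger s q u"
    and decay: "\<exists>\<alpha> C. \<alpha> > 1 \<and>
                 (\<integral>\<^sup>+ x. ennreal (exp (norm x powr \<alpha>) * (cmod (u x))\<^sup>2) \<partial>lebesgue) \<le> ennreal C"
  shows "AE x in lebesgue. u x = 0"
proof -
  define v where "v x = complex_of_real (q x) * u x" for x
  have mu [measurable]: "u \<in> borel_measurable lebesgue"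
    using u_Hs unfolding Hs_def L2_def by blast
  have "continuous_on UNIV q"
    using q_C1 by (meson continuous_at_imp_continuous_on has_derivative_continuous)
  then have "q \<in> borel_measurable lebesgue"
    by (intro measurable_completion) (simp add: borel_measurable_continuous_onI)
  then have mv [measurable]: "v \<in> borel_measurable lebesgue"
    unfolding v_def by measurable
  have [measurable]: "(\<lambda>x::real^'n. norm x) \<in> borel_measurable lebesgue"
    by (intro measurable_completion) simp
  obtain \<alpha> C where "\<alpha> > 1"
    "(\<integral>\<^sup>+ x. ennreal (exp (norm x powr \<alpha>) * (cmod (u x))\<^sup>2) \<partial>lebesgue) \<le> ennreal C"
    using decay by blast
  then have uR: "integrable lebesgue (\<lambda>x. exp (R * norm x) * cmod (u x))" for R
    by (intro integrable_exp_of_superexponential_decay[of _ \<alpha>]) (auto intro: le_less_trans)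
  have vu: "cmod (v x) \<le> cmod (u x)" for x
    using q_bd by (auto simp: v_def norm_mult intro!: mult_left_le_one_le)
  have vR: "integrable lebesgue (\<lambda>x. exp (R * norm x) * cmod (v x))" for R
    by (rule Bochner_Integration.integrable_bound[OF uR[of R]]) (use vu in auto)
  have u: "integrable lebesgue u" and v: "integrable lebesgue v"
    \<comment> \<open>At R = 0 the exponential weight is 1.\<close>
    using uR[of 0] vR[of 0] by (auto simp: integrable_norm_iff)
  have eq: "complex_of_real (norm \<xi> powr (2 * s)) * fourier_L1 u \<xi> + fourier_L1 v \<xi> = 0" for \<xi>
    using weak_frac_schroedinger_fourier[OF s u_Hs sol u] v unfolding v_def[abs_def] by blast
  have "fourier_L1 u \<xi> = 0" if "\<xi> \<noteq> 0" for \<xi>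
  proof -
    \<comment> \<open>By homogeneity the symbol at distance t along the ray is
      \<open>t powr (2 * s) * N\<close>; the constant \<open>N\<close> is absorbed into the first
      entire function.\<close>
    define N where "N = complex_of_real (norm \<xi> powr (2 * s))"
    \<comment> \<open>The line has direction -\<xi>, so that the parameter -1 lands on \<xi>
      itself.\<close>
    define E where "E w z = (\<integral>x. exp (- (\<i> * z * complex_of_real (x \<bullet> (- \<xi>)))) * w x \<partial>lebesgue)" for w z
    have E: "E w (complex_of_real t) = fourier_L1 w (t *\<^sub>R (- \<xi>))" for w t
      unfolding E_def fourier_L1_def by (simp add: cis_conv_exp mult.assoc)
    have "E u holomorphic_on UNIV" "E v holomorphic_on UNIV"
      unfolding E_def by (intro holomorphic_fourier_line mu mv uR vR)+
    moreover have "complex_of_real (t powr (2 * s)) * (N * E u (complex_of_real t)) + E v (complex_of_real t) = 0"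
      if "t > 0" for t
      using eq[of "t *\<^sub>R (- \<xi>)"] that unfolding E N_def by (simp add: powr_mult mult.assoc)
    moreover have "N * E u (- 1) + E v (- 1) = 0"
      using eq[of "(- 1) *\<^sub>R (- \<xi>)"] E[of u "- 1"] E[of v "- 1"] by (simp add: N_def)
    ultimately have "N * E u (- 1) = 0"
      using s by (intro entire_powr_monodromy[of "\<lambda>z. N * E u z" "E v" s]) (auto intro!: holomorphic_intros)
    then show ?thesis
      using E[of u "- 1"] that by (simp add: N_def)
  qed
  \<comment> \<open>At the origin \<open>N\<close> is 0 and gives no information, but a point is a
    null set.\<close>
  moreover have "AE \<xi> in lebesgue. \<xi> \<noteq> (0::real^'n)"
    using AE_not_in[OF negligible_sing[of "0::real^'n", unfolded negligible_iff_null_sets]] by simp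
  ultimately have "AE \<xi> in lebesgue. fourier_L1 u \<xi> = 0"
    by auto
  with u show ?thesis by (rule fourier_L1_inj)
qed

end
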